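(* Consider a supply chain network $G(\mathcal{A},\mathcal{V})$ with parameters $L^e,V^e,\mu^e$ and initial conditions $q^e(0)=q_0^e$ for all $e\in\mathcal{A}$. Let $\mathcal{F}(Q^e,W^e,R^e)$ be a linear objective function, and let $0=t_0<t_1<\dots<t_N=T$ be a time grid with step size $h$. Then the network optimization problem described in the context can be formulated as the following mixed integer program: $$\min_{Q_i^e,\,W_i^e,\,R_i^e}\ \mathcal{F}(Q_i^e,W_i^e,R_i^e)$$ subject to $$\sum_{e\in\mathcal{O}^v}Q_i^e=\sum_{\bar e\in\mathcal{I}^v}W_i^{\bar e},\qquad Q_{i-1}^e\le Q_i^e,\qquad 1\le i\le N,$$ $$R^e_{\Delta^e}=-\mu^et_0,\qquad R_{i-1}^e+(\beta_i^e-1)M\le R_i^e\le R_{i-1}^e,\qquad \Delta^e+1\le i\le\Delta^e+N,$$ $$q_0^e+Q_{i-\Delta^e}^e-\mu^et_{i-\Delta^e}-M\beta_i^e\le R_i^e\le q_0^e+Q_{i-\Delta^e}^e-\mu^et_{i-\Delta^e},\qquad \Delta^e+1\le i\le\Delta^e+N,$$ $$W_i^e=R_i^e+(t_i-L^e/V^e)\mu^e,\qquad \Delta^e\le i\le N,$$ $$\Delta^e=\left\lceil\frac{L^e}{V^eh}\right\rceil,\qquad \beta_i^e\in\{0,1\},\qquad e\in\mathcal{A},\quad v\in\mathcal{V},$$ where $M$ is a sufficiently large constant.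
   Context: $G(\mathcal{A},\mathcal{V})$ is a directed graph whose arcs $e\in\mathcal{A}$ are processors of length $L^e$, constant processing speed $V^e$ and constant flow capacity $\mu^e$, each with a buffer queue at its upstream end, of size $q^e(t)$ at time $t$. The initial product density on every processor is zero. For $v\in\mathcal{V}$, $\mathcal{I}^v$ and $\mathcal{O}^v$ are its sets of incoming and outgoing arcs. Network optimization problem: for $e\in\mathcal{A}$ and $t\in[0,T]$, let $Q^e(t)$ be the cumulative number of products that have arrived at the queue of $e$, and $W^e(t)$ the cumulative number of products that have left processor $e$. One minimizes an objective $\sum_{e\in\mathcal{A}}\mathcal{F}^e(Q^e,W^e)$ over the flow allocation rates $A^{v,e}(t)$, $v\in\mathcal{V}$, $e\in\mathcal{O}^v$, which satisfy $0\le A^{v,e}(t)\le1$ and $\sum_{e\in\mathcal{O}^v}A^{v,e}(t)=1$ (so $A^{v,e}\equiv1$ if $|\mathcal{O}^v|=1$), subject to: - $\frac{d}{dt}Q^e(t)=A^{v,e}(t)\sum_{\bar e\in\mathcal{I}^v}\frac{d}{dt}W^{\bar e}(t)$ for almost every $t$, for all $v\in\mathcal{V}$, $e\in\mathcal{O}^v$; - $\hat Q^e(t)=0$ for $t\le0$ and $\hat Q^e(t)=q_0^e+Q^e(t)$ for $0<t\le T$, for all $e\in\mathcal{A}$; - $W^e(t)=0$ for $t<L^e/V^e$, and $W^e(t)=\inf_{\tau\le t-L^e/V^e}\{\hat Q^e(\tau)-\mu^e\tau\}+(t-L^e/V^e)\mu^e$ for $t\ge L^e/V^e$. The formulation is by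 time discretization of this problem ("discretize-then-optimize"). $Q_i^e$ and $W_i^e$ stand for $Q^e(t_i)$ and $W^e(t_i)$, with $\hat Q^e_0=0$ and $\hat Q^e_i=q^e_0+Q^e_i$ for $1\le i\le N$. The discrete form of the last constraint is $W^e_i=0$ for $i<\Delta^e$ and $W^e_i=\min_{0\le j\le i-\Delta^e}\{\hat Q^e_j-\mu^et_j\}+(t_i-L^e/V^e)\mu^e$ for $i\ge\Delta^e$. The auxiliary variables $R^e_i$ represent the running minima: $R^e_{\Delta^e}=\hat Q^e_0-\mu^et_0$ and $R^e_i=\min\{R^e_{i-1},\ \hat Q^e_{i-\Delta^e}-\mu^et_{i-\Delta^e}\}$ for $\Delta^e<i\le N+\Delta^e$. The binary variables $\beta_i^e$ linearize this minimum. The allocation rates are implicitly described by the $Q^e_i$.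
   Formalization: The balance equation and the normalization of the allocation rates are imposed only at vertices with an outgoing arc (at a sink they would read 0 = ΣW and 0 = 1), and the conditions Q_0 = 0 and W_i = 0 for i < Δ from the context are added to the mixed integer program. *)

theory Defs
  imports "HOL-Analysis.Analysis" "Graph_Theory.Digraph"
begin

record ('v, 'e) supply_network =
  graph :: "('v, 'e) pre_digraph"
  len :: "'e \<Rightarrow> real"
  speed :: "'e \<Rightarrow> real"
  capacity :: "'e \<Rightarrow> real"
  queue0 :: "'e \<Rightarrow> real"

definition supply_chain :: "('v, 'e) supply_network \<Rightarrow> bool" where
  "supply_chain S \<longleftrightarrow> fin_digraph (graph S) \<and>
     (\<forall>e\<in>arcs (graph S). 0 < len S e \<and> 0 < speed S e \<and> 0 < capacity S e \<and> 0 \<le> queue0 S e)"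

text \<open>Quantities indexed by an arc and a time index. Only the indices that the formulation
  mentions are meaningful: \<open>0..N\<close> for Q and W, and
  \<open>\<Delta>..\<Delta> + N\<close> for R.\<close>

type_synonym 'e grid_fun = "'e \<Rightarrow> nat \<Rightarrow> real"

definition uniform_grid :: "nat \<Rightarrow> real \<Rightarrow> real \<Rightarrow> (nat \<Rightarrow> real) \<Rightarrow> bool" where
  "uniform_grid N h T t \<longleftrightarrow> 1 \<le> N \<and> 0 < h \<and> t 0 = 0 \<and> t N = T \<and>
     (\<forall>i. 1 \<le> i \<and> i \<le> N \<longrightarrow> t i - t (i - 1) = h)"

definition delay :: "('v, 'e) supply_network \<Rightarrow> real \<Rightarrow> 'e \<Rightarrow> nat" where
  "delay S h e = nat \<lceil>len S e / (speed S e * h)\<rceil>"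

definition Qhat :: "('v, 'e) supply_network \<Rightarrow> 'e grid_fun \<Rightarrow> 'e grid_fun" where
  "Qhat S Q e i = (if i = 0 then 0 else queue0 S e + Q e i)"

definition is_linear_objective ::
  "('v, 'e) supply_network \<Rightarrow> nat \<Rightarrow> real \<Rightarrow> ('e grid_fun \<Rightarrow> 'e grid_fun \<Rightarrow> 'e grid_fun \<Rightarrow> real) \<Rightarrow> bool" where
  "is_linear_objective S N h F \<longleftrightarrow>
     (\<exists>a b c. \<forall>Q W R. F Q W R =
        (\<Sum>e\<in>arcs (graph S).
           (\<Sum>i=0..N. a e i * Q e i) + (\<Sum>i=0..N. b e i * W e i)
           + (\<Sum>i=delay S h e..delay S h e + N. c e i * R e i)))"

section \<open>The time-discretized network optimization problem\<close>

text \<open>Conditions on the allocation rates \<open>A v e i\<close>, held on the step from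
  \<open>t (i - 1)\<close> to \<open>t i\<close>. A sink has no outgoing arcs and hence no allocation rates,
  and normalization there would read \<open>0 = 1\<close>; it is required only at vertices with an
  outgoing arc.\<close>

definition admissible_rates ::
  "('v, 'e) supply_network \<Rightarrow> nat \<Rightarrow> ('v \<Rightarrow> 'e grid_fun) \<Rightarrow> bool" where
  "admissible_rates S N A \<longleftrightarrow>
     (\<forall>v\<in>verts (graph S). \<forall>i\<in>{1..N}.
        (\<forall>e\<in>out_arcs (graph S) v. 0 \<le> A v e i \<and> A v e i \<le> 1) \<and>
        (out_arcs (graph S) v \<noteq> {} \<longrightarrow> (\<Sum>e\<in>out_arcs (graph S) v. A v e i) = 1))"

text \<open>The differential equation for Q becomes a relation between difference quotients.
  The condition \<open>Q e 0 = 0\<close> is the initial value of a cumulative count.\<close>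

definition discrete_flow ::
  "('v, 'e) supply_network \<Rightarrow> nat \<Rightarrow> real \<Rightarrow> 'e grid_fun \<Rightarrow> 'e grid_fun \<Rightarrow> ('v \<Rightarrow> 'e grid_fun) \<Rightarrow> bool" where
  "discrete_flow S N h Q W A \<longleftrightarrow>
     (\<forall>e\<in>arcs (graph S). Q e 0 = 0) \<and>
     (\<forall>v\<in>verts (graph S). \<forall>e\<in>out_arcs (graph S) v. \<forall>i\<in>{1..N}.
        (Q e i - Q e (i - 1)) / h =
          A v e i * (\<Sum>e'\<in>in_arcs (graph S) v. (W e' i - W e' (i - 1)) / h))"

definition discrete_outflow ::
  "('v, 'e) supply_network \<Rightarrow> nat \<Rightarrow> real \<Rightarrow> (nat \<Rightarrow> real) \<Rightarrow> 'e grid_fun \<Rightarrow> 'e grid_fun \<Rightarrow> bool" where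
  "discrete_outflow S N h t Q W \<longleftrightarrow>
     (\<forall>e\<in>arcs (graph S). \<forall>i\<le>N. W e i =
        (if i < delay S h e then 0
         else Min ((\<lambda>j. Qhat S Q e j - capacity S e * t j) ` {0..i - delay S h e})
              + (t i - len S e / speed S e) * capacity S e))"

definition running_minima ::
  "('v, 'e) supply_network \<Rightarrow> nat \<Rightarrow> real \<Rightarrow> (nat \<Rightarrow> real) \<Rightarrow> 'e grid_fun \<Rightarrow> 'e grid_fun \<Rightarrow> bool" where
  "running_minima S N h t Q R \<longleftrightarrow>
     (\<forall>e\<in>arcs (graph S).
        R e (delay S h e) = Qhat S Q e 0 - capacity S e * t 0 \<and>
        (\<forall>i. delay S h e < i \<and> i \<le> N + delay S h e \<longrightarrow>
           R e i = min (R e (i - 1))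
                       (Qhat S Q e (i - delay S h e) - capacity S e * t (i - delay S h e))))"

text \<open>R is determined by Q on the indices that matter; it is carried along because the
  objective may depend on it.\<close>

definition discrete_feasible ::
  "('v, 'e) supply_network \<Rightarrow> nat \<Rightarrow> real \<Rightarrow> (nat \<Rightarrow> real) \<Rightarrow>
     ('e grid_fun \<times> 'e grid_fun \<times> 'e grid_fun \<times> ('v \<Rightarrow> 'e grid_fun)) set" where
  "discrete_feasible S N h t =
     {(Q, W, R, A). admissible_rates S N A \<and> discrete_flow S N h Q W A \<and>
        discrete_outflow S N h t Q W \<and> running_minima S N h t Q R}"

section \<open>The mixed integer program\<close>

text \<open>The first two conditions fix the initial data: nothing has arrived at time 0 and, the
  processors being empty initially, nothing leaves a processor before its throughput time has
  elapsed. The balance equation is imposed at the vertices where flow is distributed; at a sink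
  it would forbid any product to leave the network.\<close>

definition mip_feasible ::
  "('v, 'e) supply_network \<Rightarrow> nat \<Rightarrow> real \<Rightarrow> (nat \<Rightarrow> real) \<Rightarrow> real \<Rightarrow>
     ('e grid_fun \<times> 'e grid_fun \<times> 'e grid_fun \<times> 'e grid_fun) set" where
  "mip_feasible S N h t M =
     {(Q, W, R, \<beta>).
        (\<forall>e\<in>arcs (graph S). Q e 0 = 0) \<and>
        (\<forall>e\<in>arcs (graph S). \<forall>i\<le>N. i < delay S h e \<longrightarrow> W e i = 0) \<and>
        (\<forall>v\<in>verts (graph S). out_arcs (graph S) v \<noteq> {} \<longrightarrow> (\<forall>i\<in>{1..N}.
           (\<Sum>e\<in>out_arcs (graph S) v. Q e i) = (\<Sum>e'\<in>in_arcs (graph S) v. W e' i))) \<and>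
        (\<forall>e\<in>arcs (graph S).
           (\<forall>i\<in>{1..N}. Q e (i - 1) \<le> Q e i) \<and>
           R e (delay S h e) = - capacity S e * t 0 \<and>
           (\<forall>i\<in>{delay S h e + 1..delay S h e + N}.
              \<beta> e i \<in> {0, 1} \<and>
              R e (i - 1) + (\<beta> e i - 1) * M \<le> R e i \<and>
              R e i \<le> R e (i - 1) \<and>
              queue0 S e + Q e (i - delay S h e) - capacity S e * t (i - delay S h e) - M * \<beta> e i
                \<le> R e i \<and>
              R e i \<le> queue0 S e + Q e (i - delay S h e) - capacity S e * t (i - delay S h e)) \<and>
           (\<forall>i\<in>{delay S h e..N}.
              W e i = R e i + (t i - len S e / speed S e) * capacity S e))}"

text \<open>The last component is \<open>A\<close> or \<open>\<beta>\<close>; neither enters the objective.\<close>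

definition cost ::
  "('e grid_fun \<Rightarrow> 'e grid_fun \<Rightarrow> 'e grid_fun \<Rightarrow> real) \<Rightarrow>
     'e grid_fun \<times> 'e grid_fun \<times> 'e grid_fun \<times> 'x \<Rightarrow> real" where
  "cost F = (\<lambda>(Q, W, R, _). F Q W R)"

end

theory Submission
  imports Defs
begin

text \<open>The running minima turn the outflow formula into a recursion, and a binary variable with a
  large constant encodes each minimum exactly, provided the constant dominates the difference of
  the two arguments. Such a constant can be chosen uniformly: an arc releases at most its
  capacity times \<open>T\<close>, so conservation of flow bounds every arrival count by \<open>T\<close> times the total
  capacity. Allocation rates are eliminated by summing the flow equation over the outgoing arcs
  and recovered as quotients of increments; they are nonnegative precisely because arrivals and
  departures are nondecreasing, which is shown by induction along the grid, every arc delaying by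
  at least one step.\<close>

section \<open>Encoding a minimum by a binary variable\<close>

lemma big_M_imp_min:
  fixes b M r r' x :: real
  assumes "b \<in> {0, 1}" "r' + (b - 1) * M \<le> r" "r \<le> r'" "x - M * b \<le> r" "r \<le> x"
  shows "r = min r' x"
  using assms by auto

text \<open>The variable \<open>b\<close> names the argument attaining the minimum. Its own lower
  bound is then tight, and the lower bound from the other argument has to be slack; this is where
  \<open>M\<close> must dominate the difference, in either sign.\<close>

lemma min_imp_big_M:
  fixes M r' x :: real
  assumes "x - r' \<le> M" "r' - x \<le> M"
  defines "b \<equiv> (if r' \<le> x then 1 else 0)"
  shows "r' + (b - 1) * M \<le> min r' x" "x - M * b \<le> min r' x"
  using assms by (auto simp: b_def)

section \<open>The grid and the delays of the arcs\<close>

locale discretized_network =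
  fixes S :: "('v, 'e) supply_network" and N :: nat and h T :: real and t :: "nat \<Rightarrow> real"
  assumes supply_chain: "supply_chain S" and grid: "uniform_grid N h T t"
begin

abbreviation "arcset \<equiv> arcs (graph S)"

abbreviation "\<mu> \<equiv> capacity S"

abbreviation "\<Delta> \<equiv> delay S h"

abbreviation "inflow \<equiv> in_arcs (graph S)"

abbreviation "outflow \<equiv> out_arcs (graph S)"

sublocale fin_digraph "graph S"
  using supply_chain by (simp add: supply_chain_def)

lemma arc_pos:
  assumes "e \<in> arcset"
  shows "0 < len S e" "0 < speed S e" "0 < \<mu> e" "0 \<le> queue0 S e"
  using supply_chain assms by (auto simp: supply_chain_def)

lemma h_pos: "0 < h"
  using grid by (simp add: uniform_grid_def)

lemma grid_time: "i \<le> N \<Longrightarrow> t i = real i * h"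
proof (induction i)
  case 0
  then show ?case using grid by (simp add: uniform_grid_def)
next
  case (Suc i)
  have "t (Suc i) - t (Suc i - 1) = h"
    using grid Suc.prems unfolding uniform_grid_def by (metis le_add1 plus_1_eq_Suc)
  then show ?case using Suc by (simp add: algebra_simps)
qed

lemma grid_time_bounds:
  assumes "i \<le> N"
  shows "0 \<le> t i" "t i \<le> T"
proof -
  have "t N = T" using grid by (simp add: uniform_grid_def)
  then show "0 \<le> t i" "t i \<le> T"
    using assms h_pos grid_time[of i] grid_time[of N] by auto
qed

lemma delay_pos:
  assumes "e \<in> arcset"
  shows "0 < \<Delta> e"
  using arc_pos[OF assms] h_pos by (simp add: delay_def)

text \<open>Because the delay is rounded up, the first grid point at which an arc may release
  products is not before its throughput time. Hence its first departure count is not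
  negative.\<close>

lemma throughput_time_le:
  assumes "e \<in> arcset"
  shows "len S e / speed S e \<le> real (\<Delta> e) * h"
proof -
  have "len S e / (speed S e * h) \<le> real (\<Delta> e)"
    by (simp add: delay_def real_nat_ceiling_ge)
  then have "len S e / (speed S e * h) * h \<le> real (\<Delta> e) * h"
    using h_pos by (intro mult_right_mono) auto
  moreover have "len S e / (speed S e * h) * h = len S e / speed S e"
    using h_pos by simp
  ultimately show ?thesis by argo
qed

section \<open>Running minima and the outflow formula\<close>

lemma running_minimum_eq_Min:
  assumes "running_minima S N h t Q R" "e \<in> arcset" "k \<le> N"
  shows "R e (\<Delta> e + k) = Min ((\<lambda>j. Qhat S Q e j - \<mu> e * t j) ` {0..k})"
  using assms(3)
proof (induction k)
  case 0
  then show ?case using assms by (simp add: running_minima_def)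
next
  case (Suc k)
  have "R e (\<Delta> e + Suc k)
      = min (R e (\<Delta> e + k)) (Qhat S Q e (Suc k) - \<mu> e * t (Suc k))"
    using assms(1,2) Suc.prems unfolding running_minima_def
    by (auto dest!: bspec[of _ _ e] spec[of _ "\<Delta> e + Suc k"])
  then show ?case using Suc by (simp add: atLeast0_atMost_Suc min.commute)
qed

text \<open>With the minimum replaced by \<open>R\<close>, the outflow formula takes the linear form
  of the mixed integer program.\<close>

lemma discrete_outflow_iff:
  assumes "running_minima S N h t Q R"
  shows "discrete_outflow S N h t Q W \<longleftrightarrow>
    (\<forall>e\<in>arcset. (\<forall>i\<le>N. i < \<Delta> e \<longrightarrow> W e i = 0) \<and>
      (\<forall>i\<in>{\<Delta> e..N}. W e i = R e i + (t i - len S e / speed S e) * \<mu> e))"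
proof -
  have "R e i = Min ((\<lambda>j. Qhat S Q e j - \<mu> e * t j) ` {0..i - \<Delta> e})"
    if "e \<in> arcset" "\<Delta> e \<le> i" "i \<le> N" for e i
    using running_minimum_eq_Min[OF assms that(1), of "i - \<Delta> e"] that by simp
  then show ?thesis
    unfolding discrete_outflow_def by (auto simp: not_less)
qed

section \<open>Monotonicity of arrivals and departures\<close>

lemma arrivals_nonneg:
  fixes Q :: "'e grid_fun"
  assumes "Q e 0 = 0" "\<And>i. 1 \<le> i \<Longrightarrow> i \<le> k \<Longrightarrow> Q e (i - 1) \<le> Q e i"
  shows "0 \<le> Q e k"
  using assms(2)
proof (induction k)
  case 0
  then show ?case using assms(1) by simp
next
  case (Suc k)
  then show ?case using Suc.prems[of "Suc k"] by force
qed

lemma departures_initial: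
  assumes "discrete_outflow S N h t Q W" "e \<in> arcset"
  shows "W e 0 = 0"
  using assms delay_pos[OF assms(2)] by (auto simp: discrete_outflow_def)

text \<open>In one step the running minimum drops by at most \<open>\<mu> e * h\<close>, while the
  linear term of the outflow formula grows by exactly that amount. Only arrivals strictly before
  step \<open>i\<close> enter, since the delay is at least one step; this lets the lemma serve
  inside an induction over time.\<close>

lemma departures_mono:
  assumes R: "running_minima S N h t Q R" and W: "discrete_outflow S N h t Q W"
    and e: "e \<in> arcset" and Q0: "Q e 0 = 0"
    and Q: "\<And>j. 1 \<le> j \<Longrightarrow> j < i \<Longrightarrow> Q e (j - 1) \<le> Q e j"
    and i: "1 \<le> i" "i \<le> N"
  shows "W e (i - 1) \<le> W e i"
proof -
  note pos = arc_pos[OF e]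
  have W0: "W e j = 0" if "j < \<Delta> e" "j \<le> N" for j
    using W e that by (simp add: discrete_outflow_iff[OF R])
  have WR: "W e j = R e j + (t j - len S e / speed S e) * \<mu> e" if "\<Delta> e \<le> j" "j \<le> N" for j
    using W e that by (simp add: discrete_outflow_iff[OF R])
  have ti: "t i = t (i - 1) + h"
    using grid_time[of i] grid_time[of "i - 1"] i by (simp add: of_nat_diff algebra_simps)
  consider "i < \<Delta> e" | "i = \<Delta> e" | "\<Delta> e < i" by linarith
  then show ?thesis
  proof cases
    case 1
    then show ?thesis using W0 i by simp
  next
    case 2
    have "R e i = 0"
      using R e 2 grid_time[of 0] by (simp add: running_minima_def Qhat_def)
    moreover have "len S e / speed S e \<le> t i"
      using throughput_time_le[OF e] grid_time[of i] i 2 by simp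
    ultimately show ?thesis using W0[of "i - 1"] WR[of i] i 2 pos by simp
  next
    case 3
    define k where "k = i - \<Delta> e"
    have k: "1 \<le> k" "k < i" "i = \<Delta> e + k" using 3 delay_pos[OF e] by (auto simp: k_def)
    have tk: "t k = t (k - 1) + h"
      using grid_time[of k] grid_time[of "k - 1"] i k by (simp add: of_nat_diff algebra_simps)
    have "R e i = min (R e (i - 1)) (Qhat S Q e k - \<mu> e * t k)"
      using R e 3 i unfolding running_minima_def k_def by simp
    moreover have "R e (i - 1) \<le> Qhat S Q e (k - 1) - \<mu> e * t (k - 1)"
    proof -
      have "i - 1 = \<Delta> e + (k - 1)" using k by simp
      then show ?thesis
        using running_minimum_eq_Min[OF R e, of "k - 1"] i k by (auto intro!: Min_le)
    qed
    \<comment> \<open>For \<open>k = 1\<close> this is the jump of \<open>Qhat\<close> from 0 to the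
      initial queue plus \<open>Q e 1\<close>, so the sign of the initial queue matters.\<close>
    moreover have "Qhat S Q e (k - 1) \<le> Qhat S Q e k"
      using Q[of k] k Q0 pos by (auto simp: Qhat_def)
    moreover have "0 < \<mu> e * h" using pos h_pos by simp
    ultimately have "R e (i - 1) \<le> R e i + \<mu> e * h"
      using tk by (simp add: algebra_simps min_def)
    moreover have "W e (i - 1) = R e (i - 1) + (t (i - 1) - len S e / speed S e) * \<mu> e"
      using 3 i by (intro WR) auto
    ultimately show ?thesis using WR[of i] 3 i ti by (simp add: algebra_simps)
  qed
qed

text \<open>The arrival increment at \<open>i\<close> is a nonnegative share of the departure
  increments into the tail of \<open>e\<close>. Those are nonnegative once arrivals on all arcs are
  monotone before \<open>i\<close>, so the induction over time treats all arcs at once.\<close>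

lemma arrivals_mono:
  assumes R: "running_minima S N h t Q R" and W: "discrete_outflow S N h t Q W"
    and A: "admissible_rates S N A" and flow: "discrete_flow S N h Q W A"
    and "e \<in> arcset" "1 \<le> i" "i \<le> N"
  shows "Q e (i - 1) \<le> Q e i"
  using assms(5-)
proof (induction i arbitrary: e rule: less_induct)
  case (less i)
  define v where "v = tail (graph S) e"
  have v: "v \<in> verts (graph S)" "e \<in> outflow v"
    using less.prems by (auto simp: v_def)
  have "W e' (i - 1) \<le> W e' i" if "e' \<in> inflow v" for e'
    using departures_mono[OF R W, of e' i] less that flow
    by (auto simp: discrete_flow_def)
  then have "0 \<le> (\<Sum>e'\<in>inflow v. (W e' i - W e' (i - 1)) / h)"
    using h_pos by (intro sum_nonneg) simp
  moreover have "0 \<le> A v e i"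
    using A v less.prems by (auto simp: admissible_rates_def)
  moreover have "(Q e i - Q e (i - 1)) / h = A v e i * (\<Sum>e'\<in>inflow v. (W e' i - W e' (i - 1)) / h)"
    using flow v less.prems by (auto simp: discrete_flow_def)
  ultimately have "0 \<le> (Q e i - Q e (i - 1)) / h" by simp
  then show ?case using h_pos by (simp add: zero_le_divide_iff)
qed

section \<open>Flow balance in place of allocation rates\<close>

lemma flow_balance:
  assumes W: "\<And>e. e \<in> arcset \<Longrightarrow> W e 0 = 0"
    and A: "admissible_rates S N A" and flow: "discrete_flow S N h Q W A"
    and v: "v \<in> verts (graph S)" "outflow v \<noteq> {}" and "i \<le> N"
  shows "(\<Sum>e\<in>outflow v. Q e i) = (\<Sum>e\<in>inflow v. W e i)"
  using \<open>i \<le> N\<close>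
proof (induction i)
  case 0
  have "Q e 0 = 0" if "e \<in> outflow v" for e
    using flow that by (simp add: discrete_flow_def)
  then show ?case using W by simp
next
  case (Suc i)
  define w where "w = (\<Sum>e\<in>inflow v. (W e (Suc i) - W e i) / h)"
  have "Q e (Suc i) - Q e i = A v e (Suc i) * (w * h)" if "e \<in> outflow v" for e
  proof -
    have "Suc i \<in> {1..N}" using Suc.prems by simp
    then have "(Q e (Suc i) - Q e (Suc i - 1)) / h
        = A v e (Suc i) * (\<Sum>e'\<in>inflow v. (W e' (Suc i) - W e' (Suc i - 1)) / h)"
      using flow v(1) that unfolding discrete_flow_def by blast
    then have "(Q e (Suc i) - Q e i) / h = A v e (Suc i) * w"
      by (simp add: w_def)
    then show ?thesis using h_pos by (simp add: field_simps)
  qed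
  then have "(\<Sum>e\<in>outflow v. Q e (Suc i) - Q e i) = (\<Sum>e\<in>outflow v. A v e (Suc i)) * (w * h)"
    by (simp add: sum_distrib_right)
  \<comment> \<open>Normalization removes the rates: the increments of both sides of the balance
    agree, and the counts follow from the zero initial values.\<close>
  also have "(\<Sum>e\<in>outflow v. A v e (Suc i)) = 1"
    using A v Suc.prems by (simp add: admissible_rates_def)
  also have "w * h = (\<Sum>e\<in>inflow v. W e (Suc i) - W e i)"
    using h_pos by (simp add: w_def flip: sum_divide_distrib)
  finally show ?case using Suc by (simp add: sum_subtractf)
qed

text \<open>The rate of an arc is its share of the total arrival increment leaving the vertex.
  Monotone arrivals put this share in [0, 1], and balance identifies the total with the departure
  increment entering the vertex.\<close>

lemma rates_exist:
  assumes Q0: "\<And>e. e \<in> arcset \<Longrightarrow> Q e 0 = 0" and W0: "\<And>e. e \<in> arcset \<Longrightarrow> W e 0 = 0"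
    and Q: "\<And>e i. e \<in> arcset \<Longrightarrow> i \<in> {1..N} \<Longrightarrow> Q e (i - 1) \<le> Q e i"
    and bal: "\<And>v i. v \<in> verts (graph S) \<Longrightarrow> outflow v \<noteq> {} \<Longrightarrow> i \<in> {1..N} \<Longrightarrow>
      (\<Sum>e\<in>outflow v. Q e i) = (\<Sum>e\<in>inflow v. W e i)"
  obtains A where "admissible_rates S N A" "discrete_flow S N h Q W A"
proof
  define q where "q v i = (\<Sum>e\<in>outflow v. Q e i - Q e (i - 1))" for v i
  \<comment> \<open>If nothing is sent on from \<open>v\<close>, every distribution realizes the zero increments.\<close>
  define A where "A v e i = (if q v i = 0 then 1 / real (card (outflow v))
    else (Q e i - Q e (i - 1)) / q v i)" for v e i
  have incr: "0 \<le> Q e i - Q e (i - 1)" "Q e i - Q e (i - 1) \<le> q v i"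
    if "e \<in> outflow v" "i \<in> {1..N}" for v e i
  proof -
    show "0 \<le> Q e i - Q e (i - 1)" using Q[of e i] that by auto
    show "Q e i - Q e (i - 1) \<le> q v i"
      unfolding q_def using that Q by (intro member_le_sum) auto
  qed
  show "admissible_rates S N A"
    unfolding admissible_rates_def
  proof (intro ballI conjI impI)
    fix v i e assume i: "i \<in> {1..N}" and e: "e \<in> outflow v"
    then have "card (outflow v) \<noteq> 0" by (metis card_0_eq empty_iff finite_out_arcs)
    then show "0 \<le> A v e i" "A v e i \<le> 1"
      using incr[OF e i] by (auto simp: A_def divide_le_eq)
  next
    fix v i assume "outflow v \<noteq> {}"
    then have "card (outflow v) \<noteq> 0" by (metis card_0_eq finite_out_arcs)
    then show "(\<Sum>e\<in>outflow v. A v e i) = 1"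
      by (cases "q v i = 0") (simp_all add: A_def q_def flip: sum_divide_distrib)
  qed
  show "discrete_flow S N h Q W A"
    unfolding discrete_flow_def
  proof (intro conjI ballI)
    fix e assume "e \<in> arcset"
    then show "Q e 0 = 0" by (rule Q0)
  next
    fix v e i assume v: "v \<in> verts (graph S)" and e: "e \<in> outflow v" and i: "i \<in> {1..N}"
    \<comment> \<open>The first increment also involves index 0, which the balance hypothesis omits;
      there both sides vanish.\<close>
    have bal': "(\<Sum>e\<in>outflow v. Q e j) = (\<Sum>e\<in>inflow v. W e j)" if "j \<le> N" for j
    proof (cases "j = 0")
      case True
      then show ?thesis using Q0 W0 by simp
    next
      case False
      have "outflow v \<noteq> {}" using e by blast
      then show ?thesis using bal[of v j] v that False by simp
    qed
    have "q v i = (\<Sum>e'\<in>inflow v. W e' i - W e' (i - 1))"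
      using bal'[of i] bal'[of "i - 1"] i by (auto simp: q_def sum_subtractf)
    \<comment> \<open>If the total is zero, \<open>incr\<close> squeezes the single increment to
      zero as well.\<close>
    moreover have "Q e i - Q e (i - 1) = A v e i * q v i"
      using incr[OF e i] by (auto simp: A_def)
    ultimately show "(Q e i - Q e (i - 1)) / h
        = A v e i * (\<Sum>e'\<in>inflow v. (W e' i - W e' (i - 1)) / h)"
      by (simp flip: sum_divide_distrib)
  qed
qed

section \<open>A constant that works for all arcs and steps\<close>

definition big_M :: real where
  "big_M = (\<Sum>e\<in>arcset. 2 * (\<mu> e * T) + queue0 S e)"

lemma running_minimum_nonpos:
  assumes "running_minima S N h t Q R" "e \<in> arcset" "k \<le> N"
  shows "R e (\<Delta> e + k) \<le> 0"
proof -
  have "Min ((\<lambda>j. Qhat S Q e j - \<mu> e * t j) ` {0..k}) \<le> Qhat S Q e 0 - \<mu> e * t 0"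
    by (rule Min_le) auto
  then show ?thesis
    using running_minimum_eq_Min[OF assms] grid_time[of 0] by (simp add: Qhat_def)
qed

lemma running_minimum_bound:
  assumes R: "running_minima S N h t Q R" and e: "e \<in> arcset" and "k \<le> N"
    and Q: "\<And>j. j \<le> N \<Longrightarrow> 0 \<le> Q e j"
  shows "- (\<mu> e * T) \<le> R e (\<Delta> e + k)"
proof -
  have "- (\<mu> e * T) \<le> Qhat S Q e j - \<mu> e * t j" if "j \<le> k" for j
  proof -
    have "0 \<le> Qhat S Q e j"
      using Q[of j] arc_pos[OF e] that \<open>k \<le> N\<close> by (simp add: Qhat_def)
    moreover have "\<mu> e * t j \<le> \<mu> e * T"
      using arc_pos[OF e] grid_time_bounds[of j] that \<open>k \<le> N\<close> by simp
    ultimately show ?thesis by linarith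
  qed
  then show ?thesis
    using running_minimum_eq_Min[OF R e \<open>k \<le> N\<close>] by simp
qed

text \<open>Since the running minimum is never positive, departures stay below uninterrupted
  operation at full capacity.\<close>

lemma departures_le:
  assumes R: "running_minima S N h t Q R" and W: "discrete_outflow S N h t Q W"
    and e: "e \<in> arcset" and i: "i \<le> N"
  shows "W e i \<le> \<mu> e * T"
proof (cases "i < \<Delta> e")
  case True
  then show ?thesis
    using W e i arc_pos[OF e] grid_time_bounds[of 0] by (simp add: discrete_outflow_def)
next
  case False
  have "W e i = R e i + (t i - len S e / speed S e) * \<mu> e"
    using W e i False by (simp add: discrete_outflow_iff[OF R])
  moreover have "R e i \<le> 0"
    using running_minimum_nonpos[OF R e, of "i - \<Delta> e"] i False by simp
  moreover have "(t i - len S e / speed S e) * \<mu> e \<le> T * \<mu> e"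
  proof (rule mult_right_mono)
    have "0 \<le> len S e / speed S e" using arc_pos[OF e] by simp
    then show "t i - len S e / speed S e \<le> T" using grid_time_bounds[OF i] by linarith
  qed (use arc_pos[OF e] in simp)
  ultimately show ?thesis by (simp add: mult.commute)
qed

text \<open>Arrivals at \<open>e\<close> are part of what leaves its tail, which by balance is what
  the incoming arcs release. Summing over all arcs makes the bound independent of the
  vertex.\<close>

lemma arrivals_le:
  assumes R: "running_minima S N h t Q R" and W: "discrete_outflow S N h t Q W"
    and A: "admissible_rates S N A" and flow: "discrete_flow S N h Q W A"
    and Q: "\<And>e. e \<in> arcset \<Longrightarrow> 0 \<le> Q e i" and e: "e \<in> arcset" and i: "i \<le> N"
  shows "Q e i \<le> (\<Sum>e\<in>arcset. \<mu> e * T)"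
proof -
  define v where "v = tail (graph S) e"
  have v: "v \<in> verts (graph S)" "e \<in> outflow v"
    using e by (auto simp: v_def)
  have "Q e i \<le> (\<Sum>e\<in>outflow v. Q e i)"
    using v Q by (intro member_le_sum) auto
  also have "\<dots> = (\<Sum>e\<in>inflow v. W e i)"
    using flow_balance[OF departures_initial[OF W] A flow v(1) _ i] v by blast
  also have "\<dots> \<le> (\<Sum>e\<in>inflow v. \<mu> e * T)"
    using departures_le[OF R W _ i] by (intro sum_mono) auto
  also have "\<dots> \<le> (\<Sum>e\<in>arcset. \<mu> e * T)"
  proof (rule sum_mono2)
    show "0 \<le> \<mu> e * T" if "e \<in> arcset - inflow v" for e
      using that arc_pos[of e] grid_time_bounds[of 0] by simp
  qed auto
  finally show ?thesis .
qed

lemma big_M_bounds: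
  assumes R: "running_minima S N h t Q R" and W: "discrete_outflow S N h t Q W"
    and A: "admissible_rates S N A" and flow: "discrete_flow S N h Q W A"
    and e: "e \<in> arcset" and k: "1 \<le> k" "k \<le> N"
  defines "x \<equiv> queue0 S e + Q e k - \<mu> e * t k" and "r \<equiv> R e (\<Delta> e + (k - 1))"
  shows "x - r \<le> big_M" "r - x \<le> big_M"
proof -
  have Q: "0 \<le> Q e' j" if "e' \<in> arcset" "j \<le> N" for e' j
    using flow that arrivals_mono[OF R W A flow that(1)]
    by (intro arrivals_nonneg) (auto simp: discrete_flow_def)
  have T: "0 \<le> T" using grid_time_bounds[of 0] by simp
  have r: "r \<le> 0" "- (\<mu> e * T) \<le> r"
    using running_minimum_nonpos[OF R e, of "k - 1"] running_minimum_bound[OF R e, of "k - 1"]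
      Q[OF e] k by (auto simp: r_def)
  have tk: "0 \<le> \<mu> e * t k" "\<mu> e * t k \<le> \<mu> e * T"
    using arc_pos[OF e] grid_time_bounds[of k] k by simp_all
  have Qk: "0 \<le> Q e k" "Q e k \<le> (\<Sum>e\<in>arcset. \<mu> e * T)"
    using Q[OF e] arrivals_le[OF R W A flow _ e, of k] Q k by simp_all
  have le: "\<mu> e * T + queue0 S e \<le> (\<Sum>e\<in>arcset. \<mu> e * T + queue0 S e)"
    using e T arc_pos by (intro member_le_sum) (auto simp: less_imp_le)
  \<comment> \<open>The first sum bounds the arrivals; the second covers the depth of the running
    minimum of \<open>e\<close> together with its initial queue.\<close>
  have "big_M = (\<Sum>e\<in>arcset. \<mu> e * T) + (\<Sum>e\<in>arcset. \<mu> e * T + queue0 S e)"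
    by (simp add: big_M_def sum.distrib flip: sum_distrib_left)
  then show "x - r \<le> big_M" "r - x \<le> big_M"
    using r tk Qk le arc_pos(4)[OF e] unfolding x_def by linarith+
qed

section \<open>Equivalence of the two constraint systems\<close>

lemma mip_feasible_if_discrete_feasible:
  assumes "(Q, W, R, A) \<in> discrete_feasible S N h t" and M: "big_M \<le> M"
  obtains \<beta> where "(Q, W, R, \<beta>) \<in> mip_feasible S N h t M"
proof
  have A: "admissible_rates S N A" and flow: "discrete_flow S N h Q W A"
    and W: "discrete_outflow S N h t Q W" and R: "running_minima S N h t Q R"
    using assms(1) by (auto simp: discrete_feasible_def)
  define x where "x e i = queue0 S e + Q e (i - \<Delta> e) - \<mu> e * t (i - \<Delta> e)" for e i
  \<comment> \<open>The value 1 records that the previous minimum persists, ties included.\<close>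
  define \<beta> :: "'e grid_fun" where "\<beta> e i = (if R e (i - 1) \<le> x e i then 1 else 0)" for e i
  have min: "\<beta> e i \<in> {0, 1} \<and> R e (i - 1) + (\<beta> e i - 1) * M \<le> R e i \<and> R e i \<le> R e (i - 1) \<and>
      x e i - M * \<beta> e i \<le> R e i \<and> R e i \<le> x e i"
    if e: "e \<in> arcset" and i: "i \<in> {\<Delta> e + 1..\<Delta> e + N}" for e i
  proof -
    have *: "R e i = min (R e (i - 1)) (x e i)"
      using R e i by (auto simp: running_minima_def Qhat_def x_def)
    have "\<Delta> e + (i - \<Delta> e - 1) = i - 1" "1 \<le> i - \<Delta> e" "i - \<Delta> e \<le> N" using i by auto
    then have "x e i - R e (i - 1) \<le> M" "R e (i - 1) - x e i \<le> M"
      using big_M_bounds[OF R W A flow e, of "i - \<Delta> e"] M by (auto simp: x_def)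
    from min_imp_big_M[OF this] show ?thesis
      unfolding * by (auto simp: \<beta>_def)
  qed
  show "(Q, W, R, \<beta>) \<in> mip_feasible S N h t M"
    unfolding mip_feasible_def mem_Collect_eq prod.case
  proof (intro conjI)
    show "\<forall>e\<in>arcset. Q e 0 = 0"
      using flow by (simp add: discrete_flow_def)
    show "\<forall>e\<in>arcset. \<forall>i\<le>N. i < \<Delta> e \<longrightarrow> W e i = 0"
      using W by (simp add: discrete_outflow_def)
    show "\<forall>v\<in>verts (graph S). outflow v \<noteq> {} \<longrightarrow> (\<forall>i\<in>{1..N}.
        (\<Sum>e\<in>outflow v. Q e i) = (\<Sum>e\<in>inflow v. W e i))"
      using flow_balance[OF departures_initial[OF W] A flow] by simp
  next
    have "R e (\<Delta> e) = - \<mu> e * t 0" if "e \<in> arcset" for e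
      using R that by (simp add: running_minima_def Qhat_def)
    moreover have "W e i = R e i + (t i - len S e / speed S e) * \<mu> e"
      if "e \<in> arcset" "i \<in> {\<Delta> e..N}" for e i
      using W that by (simp add: discrete_outflow_iff[OF R])
    moreover have "Q e (i - 1) \<le> Q e i" if "e \<in> arcset" "i \<in> {1..N}" for e i
      using arrivals_mono[OF R W A flow] that by simp
    ultimately show "\<forall>e\<in>arcset. (\<forall>i\<in>{1..N}. Q e (i - 1) \<le> Q e i) \<and> R e (\<Delta> e) = - \<mu> e * t 0 \<and>
        (\<forall>i\<in>{\<Delta> e + 1..\<Delta> e + N}. \<beta> e i \<in> {0, 1} \<and> R e (i - 1) + (\<beta> e i - 1) * M \<le> R e i \<and>
           R e i \<le> R e (i - 1) \<and>
           queue0 S e + Q e (i - \<Delta> e) - \<mu> e * t (i - \<Delta> e) - M * \<beta> e i \<le> R e i \<and>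
           R e i \<le> queue0 S e + Q e (i - \<Delta> e) - \<mu> e * t (i - \<Delta> e)) \<and>
        (\<forall>i\<in>{\<Delta> e..N}. W e i = R e i + (t i - len S e / speed S e) * \<mu> e)"
      using min unfolding x_def by blast
  qed
qed

text \<open>This direction holds for every \<open>M\<close>: the binary constraints force
  \<open>R\<close> to be the running minimum, which yields the outflow formula, and the rates are
  then recovered from balance and monotone arrivals.\<close>

lemma discrete_feasible_if_mip_feasible:
  assumes mip: "(Q, W, R, \<beta>) \<in> mip_feasible S N h t M"
  obtains A where "(Q, W, R, A) \<in> discrete_feasible S N h t"
proof -
  have Q0: "Q e 0 = 0" and W0: "\<And>i. i \<le> N \<Longrightarrow> i < \<Delta> e \<Longrightarrow> W e i = 0"
    and Q: "\<And>i. i \<in> {1..N} \<Longrightarrow> Q e (i - 1) \<le> Q e i"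
    and R0: "R e (\<Delta> e) = - \<mu> e * t 0"
    and WR: "\<And>i. i \<in> {\<Delta> e..N} \<Longrightarrow> W e i = R e i + (t i - len S e / speed S e) * \<mu> e"
    if "e \<in> arcset" for e
    using mip that unfolding mip_feasible_def by auto
  have bal: "(\<Sum>e\<in>outflow v. Q e i) = (\<Sum>e\<in>inflow v. W e i)"
    if "v \<in> verts (graph S)" "outflow v \<noteq> {}" "i \<in> {1..N}" for v i
    using mip that unfolding mip_feasible_def by auto
  have Rmin: "R e i = min (R e (i - 1)) (queue0 S e + Q e (i - \<Delta> e) - \<mu> e * t (i - \<Delta> e))"
    if "e \<in> arcset" "\<Delta> e < i" "i \<le> N + \<Delta> e" for e i
  proof (rule big_M_imp_min[where M = M and b = "\<beta> e i"])
    have "i \<in> {\<Delta> e + 1..\<Delta> e + N}" using that by auto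
    then show "\<beta> e i \<in> {0, 1}" "R e (i - 1) + (\<beta> e i - 1) * M \<le> R e i" "R e i \<le> R e (i - 1)"
      "queue0 S e + Q e (i - \<Delta> e) - \<mu> e * t (i - \<Delta> e) - M * \<beta> e i \<le> R e i"
      "R e i \<le> queue0 S e + Q e (i - \<Delta> e) - \<mu> e * t (i - \<Delta> e)"
      using mip that(1) unfolding mip_feasible_def mem_Collect_eq prod.case by blast+
  qed
  have R: "running_minima S N h t Q R"
    using R0 Rmin unfolding running_minima_def by (simp add: Qhat_def)
  have W: "discrete_outflow S N h t Q W"
    using W0 WR by (simp add: discrete_outflow_iff[OF R])
  obtain A where "admissible_rates S N A" "discrete_flow S N h Q W A"
    using rates_exist[OF Q0 departures_initial[OF W] Q bal] by blast
  then show thesis using that R W by (auto simp: discrete_feasible_def)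
qed

lemma feasible_iff:
  assumes "big_M \<le> M"
  shows "(\<exists>A. (Q, W, R, A) \<in> discrete_feasible S N h t) \<longleftrightarrow>
    (\<exists>\<beta>. (Q, W, R, \<beta>) \<in> mip_feasible S N h t M)"
  by (meson assms mip_feasible_if_discrete_feasible discrete_feasible_if_mip_feasible)

end

section \<open>Transfer to optimal values and minimizers\<close>

lemma cost_image:
  "(\<lambda>x. ereal (cost F x)) ` X = {ereal (F Q W R) | Q W R. \<exists>a. (Q, W, R, a) \<in> X}"
  by (force simp: cost_def image_iff)

text \<open>The cost ignores the last component, so minimality depends only on the projection of the
  feasible set to \<open>(Q, W, R)\<close>. This projection is what the two problems share.\<close>

lemma is_arg_min_cost_iff:
  "(\<exists>a. is_arg_min (cost F) (\<lambda>x. x \<in> X) (Q, W, R, a)) \<longleftrightarrow>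
    (\<exists>a. (Q, W, R, a) \<in> X) \<and> (\<forall>Q' W' R'. (\<exists>a. (Q', W', R', a) \<in> X) \<longrightarrow> F Q W R \<le> F Q' W' R')"
  by (auto simp: is_arg_min_def cost_def not_less)

theorem theorem4p2:
  fixes S :: "('v, 'e) supply_network"
    and F :: "'e grid_fun \<Rightarrow> 'e grid_fun \<Rightarrow> 'e grid_fun \<Rightarrow> real"
    and N :: nat and h T :: real and t :: "nat \<Rightarrow> real"
  assumes "supply_chain S"
    and "is_linear_objective S N h F"
    and "uniform_grid N h T t"
  shows "\<exists>M0. \<forall>M\<ge>M0.
    (\<forall>Q W R. (\<exists>A. (Q, W, R, A) \<in> discrete_feasible S N h t) \<longleftrightarrow>
              (\<exists>\<beta>. (Q, W, R, \<beta>) \<in> mip_feasible S N h t M)) \<and>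
    (\<forall>Q W R. (\<exists>A. is_arg_min (cost F) (\<lambda>x. x \<in> discrete_feasible S N h t) (Q, W, R, A)) \<longleftrightarrow>
              (\<exists>\<beta>. is_arg_min (cost F) (\<lambda>x. x \<in> mip_feasible S N h t M) (Q, W, R, \<beta>))) \<and>
    (INF x\<in>discrete_feasible S N h t. ereal (cost F x)) =
      (INF x\<in>mip_feasible S N h t M. ereal (cost F x))"
proof -
  interpret discretized_network S N h T t
    using assms by unfold_locales
  show ?thesis
    by (intro exI[of _ big_M] allI impI)
      (simp only: is_arg_min_cost_iff cost_image feasible_iff simp_thms)
qed

end
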